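(* Let $\widehat{T}=(\lambda,a',s)$ be a Heisenberg translation, and let $Z(\widehat{T})$ be its centralizer in $\widehat{G}$. Then: (1) If $a'=0$ (i.e. $\widehat{T}$ is a vertical translation), $Z(\widehat{T})$ consists of all non-hyperbolic isometries in $\widehat{G}_\infty$. (2) If $a'\neq0$ (i.e. $\widehat{T}$ is a non-vertical translation), then $$Z(\widehat{T})=\left\{\begin{bmatrix}\lambda'&\langle\cdot,U^{-1}(b')\rangle&\lambda't\\0&U&\lambda'b'\\0&0&\lambda'\end{bmatrix}\in\widehat{G}_\infty\ :\ U(a')=\lambda'a',\ \langle b',a'\rangle\in\mathbb{R}\right\}.$$
   Context: $H$ is a complex Hilbert space with inner product $\langle\cdot,\cdot\rangle$ (linear in the first variable), $B$ its open unit ball, $e\in\partial B$ a fixed unit vector; each $x\in H$ is written $x=\langle x,e\rangle e+x'$ with $x'\in\langle e\rangle^{\perp}$. On $H\oplus\mathbb{C}$ consider the Hermitian forms $\mathcal{A}((x,z),(y,w))=\langle x,y\rangle-z\overline{w}$ and $\widehat{\mathcal{A}}((x,z),(y,w))=-z\overline{\langle y,e\rangle}-\langle x,e\rangle\overline{w}+\langle x',y'\rangle$. $G$ (resp. $\widehat{G}$) is the group of all bijective bounded linear operators on $H\oplus\mathbb{C}$ preserving $\mathcal{A}$ (resp. $\widehat{\mathcal{A}}$). Let $D$ be the unitary operator with $D(e,0)=\frac{1}{\sqrt2}(e,1)$, $D(0,1)=\frac{1}{\sqrt2}(-e,1)$, $D=I$ on $\langle e\rangle^{\perp}$; then $\widehat{G}=D^{-1}GD$.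 Each $T\in G$ acts on $\overline{B}$ by $\widetilde{T}(x)=y/w$ where $T(x,1)=(y,w)$. $T$ is elliptic if $\widetilde{T}$ has a fixed point in $B$; it is hyperbolic if it is not elliptic and $\widetilde{T}$ has exactly two fixed points in $\overline{B}$, lying on $\partial B$. $\widehat{T}=D^{-1}TD\in\widehat{G}$ is called hyperbolic if $T$ is. $\widehat{G}_\infty$ is the stabilizer of $\infty$, i.e. the set of $\widehat{T}\in\widehat{G}$ having $(e,0)$ as an eigenvector. Block matrices are relative to $H\oplus\mathbb{C}=\langle e\rangle\oplus\langle e\rangle^{\perp}\oplus\mathbb{C}$. Every element of $\widehat{G}_\infty$ has the form $\begin{bmatrix}\lambda'&\langle\cdot,U^{-1}(b')\rangle&\mu't\\0&U&\mu'b'\\0&0&\mu'\end{bmatrix}$ with $\lambda'\overline{\mu'}=1$, $U$ a unitary operator on $\langle e\rangle^{\perp}$, $b'\in\langle e\rangle^{\perp}$, $t\in\mathbb{C}$, $\operatorname{Re}t=\frac12\|b'\|^2$; in (2), $\lambda',U,b',t$ are of this kind (with $\mu'=\lambda'$). A Heisenberg translation is $$(\lambda,a',s)=\lambda\begin{bmatrix}1&\langle\cdot,a'\rangle&s\\0&I&a'\\0&0&1\end{bmatrix},\quad |\lambda|=1,\ a'\in\langle e\rangle^{\perp},\ s\in\mathbb{C},\ s\neq0,\ \operatorname{Re}s=\tfrac12\|a'\|^2.$$ *)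

theory Defs
  imports "HOL-Analysis.Analysis"
begin

section \<open>Complex Hilbert spaces\<close>

class complex_vector = real_vector +
  fixes scaleC :: "complex \<Rightarrow> 'a \<Rightarrow> 'a"  (infixr \<open>*\<^sub>C\<close> 75)
  assumes scaleC_add_right: "c *\<^sub>C (x + y) = c *\<^sub>C x + c *\<^sub>C y"
    and scaleC_add_left: "(c + d) *\<^sub>C x = c *\<^sub>C x + d *\<^sub>C x"
    and scaleC_scaleC: "c *\<^sub>C d *\<^sub>C x = (c * d) *\<^sub>C x"
    and scaleR_scaleC: "r *\<^sub>R x = complex_of_real r *\<^sub>C x"

text \<open>The inner product is linear in its first argument.  Positive definiteness is contained in the
  axiom linking it to the norm.\<close>

class complex_inner = complex_vector + real_normed_vector +
  fixes cinner :: "'a \<Rightarrow> 'a \<Rightarrow> complex"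
  assumes cinner_commute: "cinner x y = cnj (cinner y x)"
    and cinner_add_left: "cinner (x + y) z = cinner x z + cinner y z"
    and cinner_scaleC_left: "cinner (c *\<^sub>C x) y = c * cinner x y"
    and cinner_self: "cinner x x = complex_of_real ((norm x)\<^sup>2)"

class complex_hilbert_space = complex_inner + complete_space

instantiation complex :: complex_hilbert_space
begin
definition scaleC_complex :: "complex \<Rightarrow> complex \<Rightarrow> complex"
  where "scaleC_complex c x = c * x"
definition cinner_complex :: "complex \<Rightarrow> complex \<Rightarrow> complex"
  where "cinner_complex x y = x * cnj y"
instance
  by standard
    (simp_all add: scaleC_complex_def cinner_complex_def algebra_simps scaleR_conv_of_real
      flip: complex_norm_square)
end

text \<open>The direct sum \<open>H \<oplus> \<complex>\<close> is the type \<open>'a \<times> complex\<close>, with the norm of the library, which is the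
  Hilbert sum norm.\<close>

instantiation prod :: (complex_vector, complex_vector) complex_vector
begin
definition scaleC_prod :: "complex \<Rightarrow> 'a \<times> 'b \<Rightarrow> 'a \<times> 'b"
  where "scaleC_prod c v = (c *\<^sub>C fst v, c *\<^sub>C snd v)"
instance
  by standard
    (simp_all add: scaleC_prod_def scaleC_add_right scaleC_add_left scaleC_scaleC
      scaleR_scaleC prod_eq_iff)
end

definition bounded_clinear ::
  "('a::{complex_vector,real_normed_vector} \<Rightarrow> 'b::{complex_vector,real_normed_vector}) \<Rightarrow> bool"
  where "bounded_clinear T \<longleftrightarrow> bounded_linear T \<and> (\<forall>c v. T (c *\<^sub>C v) = c *\<^sub>C T v)"

definition perp :: "'a::complex_inner \<Rightarrow> 'a set"
  where "perp e = {x. cinner x e = 0}"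

text \<open>The component \<open>x'\<close> in \<open>x = \<langle>x, e\<rangle> e + x'\<close>.\<close>

definition perp_part :: "'a::complex_inner \<Rightarrow> 'a \<Rightarrow> 'a"
  where "perp_part e x = x - cinner x e *\<^sub>C e"

text \<open>Operators on a subspace are total functions whose values outside the subspace are ignored.
  Boundedness of a unitary operator follows from preservation of the inner product.\<close>

definition unitary_on :: "'a::complex_inner set \<Rightarrow> ('a \<Rightarrow> 'a) \<Rightarrow> bool"
  where "unitary_on V U \<longleftrightarrow> bij_betw U V V \<and>
    (\<forall>x\<in>V. \<forall>y\<in>V. U (x + y) = U x + U y) \<and>
    (\<forall>c. \<forall>x\<in>V. U (c *\<^sub>C x) = c *\<^sub>C U x) \<and>
    (\<forall>x\<in>V. \<forall>y\<in>V. cinner (U x) (U y) = cinner x y)"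


section \<open>The groups and their action on the closed ball\<close>

fun form_A :: "'a::complex_inner \<times> complex \<Rightarrow> 'a \<times> complex \<Rightarrow> complex"
  where "form_A (x, z) (y, w) = cinner x y - z * cnj w"

fun form_A_hat :: "'a::complex_inner \<Rightarrow> 'a \<times> complex \<Rightarrow> 'a \<times> complex \<Rightarrow> complex"
  where "form_A_hat e (x, z) (y, w) =
    - z * cnj (cinner y e) - cinner x e * cnj w + cinner (perp_part e x) (perp_part e y)"

definition preserving_group ::
  "('a::complex_inner \<times> complex \<Rightarrow> 'a \<times> complex \<Rightarrow> complex) \<Rightarrow>
   ('a \<times> complex \<Rightarrow> 'a \<times> complex) set"
  where "preserving_group F =
    {T. bij T \<and> bounded_clinear T \<and> (\<forall>u v. F (T u) (T v) = F u v)}"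

definition G :: "('a::complex_inner \<times> complex \<Rightarrow> 'a \<times> complex) set"
  where "G = preserving_group form_A"

definition G_hat :: "'a::complex_inner \<Rightarrow> ('a \<times> complex \<Rightarrow> 'a \<times> complex) set"
  where "G_hat e = preserving_group (form_A_hat e)"

definition G_hat_infinity :: "'a::complex_inner \<Rightarrow> ('a \<times> complex \<Rightarrow> 'a \<times> complex) set"
  where "G_hat_infinity e = {T \<in> G_hat e. \<exists>c. T (e, 0) = c *\<^sub>C (e, 0)}"

definition ball_action :: "('a::complex_inner \<times> complex \<Rightarrow> 'a \<times> complex) \<Rightarrow> 'a \<Rightarrow> 'a"
  where "ball_action T x = inverse (snd (T (x, 1))) *\<^sub>C fst (T (x, 1))"

definition elliptic :: "('a::complex_inner \<times> complex \<Rightarrow> 'a \<times> complex) \<Rightarrow> bool"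
  where "elliptic T \<longleftrightarrow> (\<exists>x\<in>ball 0 1. ball_action T x = x)"

definition hyperbolic :: "('a::complex_inner \<times> complex \<Rightarrow> 'a \<times> complex) \<Rightarrow> bool"
  where "hyperbolic T \<longleftrightarrow> \<not> elliptic T \<and>
    card {x \<in> cball 0 1. ball_action T x = x} = 2 \<and>
    {x \<in> cball 0 1. ball_action T x = x} \<subseteq> sphere 0 1"

definition D_op :: "'a::complex_inner \<Rightarrow> 'a \<times> complex \<Rightarrow> 'a \<times> complex"
  where "D_op e = (\<lambda>(x, z).
    (((cinner x e - z) / sqrt 2) *\<^sub>C e + perp_part e x, (cinner x e + z) / sqrt 2))"

text \<open>The operator \<open>D\<close> was described by its values; \<open>D_op_e\<close>, \<open>D_op_1\<close> and \<open>D_op_perp\<close> below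
  recover them.\<close>

lemma scaleC_0_left [simp]: "0 *\<^sub>C x = (0::'a::complex_vector)"
  using scaleR_scaleC[of 0 x] by simp

lemma scaleC_1_left [simp]: "1 *\<^sub>C x = (x::'a::complex_vector)"
  using scaleR_scaleC[of 1 x] by simp

lemma scaleC_0_right [simp]: "c *\<^sub>C 0 = (0::'a::complex_vector)"
  using scaleC_add_right[of c 0 0] by simp

lemma scaleC_minus_right: "c *\<^sub>C (- x) = - (c *\<^sub>C (x::'a::complex_vector))"
  using scaleC_add_right[of c x "- x"] by (simp add: eq_neg_iff_add_eq_0 add.commute)

lemma scaleC_minus_left: "(- c) *\<^sub>C x = - (c *\<^sub>C (x::'a::complex_vector))"
  using scaleC_add_left[of c "- c" x] by (simp add: eq_neg_iff_add_eq_0 add.commute)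

lemma cinner_0_left [simp]: "cinner 0 x = 0"
  using cinner_scaleC_left[of 0 0 x] by simp

lemma D_op_e: "norm e = 1 \<Longrightarrow> D_op e (e, 0) = complex_of_real (1 / sqrt 2) *\<^sub>C (e, 1)"
  by (simp add: D_op_def perp_part_def cinner_self scaleC_prod_def scaleC_complex_def)

lemma D_op_1: "D_op e (0, 1) = complex_of_real (1 / sqrt 2) *\<^sub>C (- e, 1)"
  by (simp add: D_op_def perp_part_def scaleC_prod_def scaleC_complex_def
      scaleC_minus_left scaleC_minus_right)

lemma D_op_perp: "x \<in> perp e \<Longrightarrow> D_op e (x, 0) = (x, 0)"
  by (simp add: D_op_def perp_part_def perp_def)

lemma bij_D_op:
  assumes "norm e = 1"
  shows "bij (D_op e)"
proof -
  define E where "E = (\<lambda>(y, w).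
    (((cinner y e + w) / sqrt 2) *\<^sub>C e + perp_part e y, (w - cinner y e) / sqrt 2))"
  have ee: "cinner e e = 1" using assms by (simp add: cinner_self)
  have neg: "cinner (- x) e = - cinner x e" for x
    using cinner_add_left[of x "- x" e] by (simp add: eq_neg_iff_add_eq_0 add.commute)
  have in_e: "cinner (c *\<^sub>C e + perp_part e x) e = c" for c x
    using cinner_add_left[of x "- (cinner x e *\<^sub>C e)" e]
    by (simp add: perp_part_def cinner_add_left cinner_scaleC_left ee neg)
  have perp: "perp_part e (c *\<^sub>C e + perp_part e x) = perp_part e x" for c x
    unfolding perp_part_def[of e "c *\<^sub>C e + perp_part e x"] in_e by simp
  have dec: "cinner x e *\<^sub>C e + perp_part e x = x" for x
    by (simp add: perp_part_def)
  have sq: "complex_of_real (sqrt 2) * complex_of_real (sqrt 2) = 2"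
    by (simp flip: of_real_mult)
  have half: "(p / complex_of_real (sqrt 2) + q / complex_of_real (sqrt 2)) /
      complex_of_real (sqrt 2) = (p + q) / 2"
    "(p / complex_of_real (sqrt 2) - q / complex_of_real (sqrt 2)) /
      complex_of_real (sqrt 2) = (p - q) / 2" for p q
    by (simp_all add: sq flip: add_divide_distrib diff_divide_distrib)
  have "E (D_op e v) = v" "D_op e (E v) = v" for v
    by (cases v; simp add: E_def D_op_def in_e perp dec half)+
  then show ?thesis by (intro o_bij[of E]) (auto simp: fun_eq_iff)
qed

definition hyperbolic_hat ::
  "'a::complex_inner \<Rightarrow> ('a \<times> complex \<Rightarrow> 'a \<times> complex) \<Rightarrow> bool"
  where "hyperbolic_hat e S \<longleftrightarrow> (\<exists>T\<in>G. S = inv (D_op e) \<circ> T \<circ> D_op e \<and> hyperbolic T)"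

definition centralizer :: "('b \<Rightarrow> 'b) set \<Rightarrow> ('b \<Rightarrow> 'b) \<Rightarrow> ('b \<Rightarrow> 'b) set"
  where "centralizer K T = {S \<in> K. S \<circ> T = T \<circ> S}"


section \<open>Block matrices and Heisenberg translations\<close>

text \<open>\<open>upper_block e p f q U b r\<close> is the operator with rows \<open>(p, f, q)\<close>, \<open>(0, U, b)\<close>, \<open>(0, 0, r)\<close>
  relative to \<open>\<langle>e\<rangle> \<oplus> \<langle>e\<rangle>\<^sup>\<bottom> \<oplus> \<complex>\<close>; a vector stands for the linear map from \<open>\<complex>\<close> sending 1 to it.\<close>

definition upper_block ::
  "'a::complex_inner \<Rightarrow> complex \<Rightarrow> ('a \<Rightarrow> complex) \<Rightarrow> complex \<Rightarrow> ('a \<Rightarrow> 'a) \<Rightarrow> 'a \<Rightarrow> complex \<Rightarrow>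
   'a \<times> complex \<Rightarrow> 'a \<times> complex"
  where "upper_block e p f q U b r = (\<lambda>(x, z).
    ((p * cinner x e + f (perp_part e x) + q * z) *\<^sub>C e + (U (perp_part e x) + z *\<^sub>C b), r * z))"

definition heisenberg ::
  "'a::complex_inner \<Rightarrow> complex \<Rightarrow> 'a \<Rightarrow> complex \<Rightarrow> 'a \<times> complex \<Rightarrow> 'a \<times> complex"
  where "heisenberg e lam a s = (\<lambda>v. lam *\<^sub>C upper_block e 1 (\<lambda>x. cinner x a) s (\<lambda>x. x) a 1 v)"

end

theory Submission
  imports Defs
begin

text \<open>Write \<open>S\<close> in the stabilizer of infinity as a block matrix with bottom right entry \<open>\<mu>\<close>.
  Any operator commuting with the translation stabilizes infinity, and comparing blocks then turns
  commutation into \<open>|\<mu>| = 1\<close> when \<open>a = 0\<close>, and into the listed conditions on \<open>U\<close> and \<open>b\<close>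
  otherwise.  It remains to see that \<open>S\<close> is hyperbolic exactly when \<open>|\<mu>| \<noteq> 1\<close>.  In that case
  \<open>U - \<mu>\<close> is invertible, by a contraction argument, which gives exactly one eigenline of \<open>S\<close>
  besides that of \<open>(e, 0)\<close> that can meet the closed ball; it is isotropic because its eigenvalue
  is not unimodular.\<close>

section \<open>Complex inner product spaces\<close>

lemma cinner_add_right: "cinner x (y + z) = cinner x y + cinner x (z::'a::complex_inner)"
  by (metis cinner_commute cinner_add_left complex_cnj_add)

lemma cinner_scaleC_right: "cinner x (c *\<^sub>C y) = cnj c * cinner x (y::'a::complex_inner)"
  by (metis cinner_commute cinner_scaleC_left complex_cnj_mult)

lemma cinner_0_right [simp]: "cinner x (0::'a::complex_inner) = 0"
  by (metis cinner_commute cinner_0_left complex_cnj_zero)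

lemma cinner_minus_left: "cinner (- x) y = - cinner x (y::'a::complex_inner)"
  using cinner_add_left[of x "- x" y] by (simp add: eq_neg_iff_add_eq_0 add.commute)

lemma cinner_diff_left: "cinner (x - y) z = cinner x z - cinner y (z::'a::complex_inner)"
  using cinner_add_left[of x "- y" z] by (simp add: cinner_minus_left)

lemma cinner_diff_right: "cinner x (y - z) = cinner x y - cinner x (z::'a::complex_inner)"
  by (metis cinner_commute cinner_diff_left complex_cnj_diff)

lemmas cinner_simps = cinner_add_left cinner_add_right cinner_scaleC_left cinner_scaleC_right
  cinner_diff_left cinner_diff_right

lemma scaleC_diff_right: "c *\<^sub>C (x - y) = c *\<^sub>C x - c *\<^sub>C (y::'a::complex_vector)"
  using scaleC_add_right[of c x "- y"] by (simp add: scaleC_minus_right)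

lemma scaleC_diff_left: "(c - d) *\<^sub>C x = c *\<^sub>C x - d *\<^sub>C (x::'a::complex_vector)"
  using scaleC_add_left[of c "- d" x] by (simp add: scaleC_minus_left)

lemma scaleC_eq_0_iff [simp]: "c *\<^sub>C x = 0 \<longleftrightarrow> c = 0 \<or> x = (0::'a::complex_vector)"
proof
  assume "c *\<^sub>C x = 0"
  then show "c = 0 \<or> x = 0"
    using scaleC_scaleC[of "inverse c" c x] by (cases "c = 0") auto
qed auto

lemma scaleC_left_cancel: "c \<noteq> 0 \<Longrightarrow> c *\<^sub>C x = c *\<^sub>C y \<longleftrightarrow> x = (y::'a::complex_vector)"
  by (metis scaleC_diff_right scaleC_eq_0_iff right_minus_eq)

lemma norm_eq_iff_cinner_self:
  fixes x y :: "'a::complex_inner"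
  shows "norm x = norm y \<longleftrightarrow> cinner x x = cinner y y"
  by (simp add: cinner_self flip: of_real_power)

text \<open>The class axioms give homogeneity of the norm for real scalars only; the complex case is
  read off from \<open>cinner_self\<close>.\<close>

lemma norm_scaleC: "norm (c *\<^sub>C x) = cmod c * norm (x::'a::complex_inner)"
proof -
  have "complex_of_real ((norm (c *\<^sub>C x))\<^sup>2) = complex_of_real ((cmod c * norm x)\<^sup>2)"
    unfolding cinner_self[symmetric] power_mult_distrib of_real_mult
    by (simp add: cinner_simps cinner_complex_def)
  then show ?thesis
    by (simp only: of_real_eq_iff power2_eq_iff_nonneg norm_ge_zero mult_nonneg_nonneg)
qed

lemma perp_add: "x \<in> perp e \<Longrightarrow> y \<in> perp e \<Longrightarrow> x + y \<in> perp e"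
  and perp_diff: "x \<in> perp e \<Longrightarrow> y \<in> perp e \<Longrightarrow> x - y \<in> perp e"
  and perp_scaleC: "x \<in> perp e \<Longrightarrow> c *\<^sub>C x \<in> perp e"
  and perp_0: "0 \<in> perp e"
  and perp_uminus: "x \<in> perp e \<Longrightarrow> - x \<in> perp e"
  by (simp_all add: perp_def cinner_simps cinner_minus_left)

lemmas perp_intros = perp_add perp_diff perp_scaleC perp_0 perp_uminus

lemma cinner_perp: "x \<in> perp e \<Longrightarrow> cinner x e = 0" "x \<in> perp e \<Longrightarrow> cinner e x = 0"
  using cinner_commute[of e x] by (auto simp: perp_def)

lemma perp_part_perp: "x \<in> perp e \<Longrightarrow> perp_part e x = x"
  by (simp add: perp_part_def perp_def)

lemma e_perp_decomp: "x = cinner x e *\<^sub>C e + perp_part e x"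
  by (simp add: perp_part_def)

section \<open>Unitary operators on a subspace and their inverses\<close>

context
  fixes V :: "'a::complex_inner set" and U :: "'a \<Rightarrow> 'a"
  assumes U: "unitary_on V U"
begin

lemma unitary_on_mem: "x \<in> V \<Longrightarrow> U x \<in> V"
  and unitary_on_add: "x \<in> V \<Longrightarrow> y \<in> V \<Longrightarrow> U (x + y) = U x + U y"
  and unitary_on_scaleC: "x \<in> V \<Longrightarrow> U (c *\<^sub>C x) = c *\<^sub>C U x"
  and unitary_on_cinner: "x \<in> V \<Longrightarrow> y \<in> V \<Longrightarrow> cinner (U x) (U y) = cinner x y"
  using U by (auto simp: unitary_on_def bij_betw_def)

lemma unitary_on_norm: "x \<in> V \<Longrightarrow> norm (U x) = norm x"
  by (simp add: norm_eq_iff_cinner_self unitary_on_cinner)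

lemma
  shows unitary_on_inv_mem: "y \<in> V \<Longrightarrow> inv_into V U y \<in> V"
    and unitary_on_right_inv: "y \<in> V \<Longrightarrow> U (inv_into V U y) = y"
    and unitary_on_left_inv: "x \<in> V \<Longrightarrow> inv_into V U (U x) = x"
  using U unfolding unitary_on_def bij_betw_def
  by (metis inv_into_into, metis f_inv_into_f, metis inv_into_f_f)

text \<open>The adjoint of a unitary operator is its inverse. This converts the block entry
  \<open>cinner x (inv_into V U b)\<close> of the theorem into \<open>cinner (U x) b\<close>, the
  shape used in all computations.\<close>

lemma cinner_unitary_on_inv:
  "x \<in> V \<Longrightarrow> y \<in> V \<Longrightarrow> cinner x (inv_into V U y) = cinner (U x) y"
  by (metis unitary_on_cinner unitary_on_inv_mem unitary_on_right_inv)

end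

lemma unitary_on_diff:
  assumes "unitary_on (perp e) U" "x \<in> perp e" "y \<in> perp e"
  shows "U (x - y) = U x - U y"
  using unitary_on_add[OF assms(1), of "x - y" y] assms by (simp add: perp_intros)

text \<open>Equations U d + b = k d with |k| < 1 are solved below through the inverse of U, which
  therefore has to be unitary itself.\<close>

lemma unitary_on_inv:
  assumes "unitary_on (perp e) U"
  shows "unitary_on (perp e) (inv_into (perp e) U)"
  unfolding unitary_on_def
proof (intro conjI ballI allI)
  show "bij_betw (inv_into (perp e) U) (perp e) (perp e)"
    using assms by (simp add: unitary_on_def bij_betw_inv_into)
next
  fix x y assume xy: "x \<in> perp e" "y \<in> perp e"
  let ?V = "inv_into (perp e) U"
  note m = unitary_on_inv_mem[OF assms] unitary_on_right_inv[OF assms]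
  show "?V (x + y) = ?V x + ?V y"
    by (metis xy m perp_add unitary_on_add[OF assms] unitary_on_left_inv[OF assms])
  show "cinner (?V x) (?V y) = cinner x y"
    by (metis xy m unitary_on_cinner[OF assms])
next
  fix c x assume x: "x \<in> perp e"
  let ?V = "inv_into (perp e) U"
  note m = unitary_on_inv_mem[OF assms] unitary_on_right_inv[OF assms]
  show "?V (c *\<^sub>C x) = c *\<^sub>C ?V x"
    by (metis x m perp_scaleC unitary_on_scaleC[OF assms] unitary_on_left_inv[OF assms])
qed

section \<open>Coordinates relative to a unit vector\<close>

context
  fixes e :: "'a::complex_inner"
  assumes unit: "norm e = 1"
begin

lemma cinner_unit: "cinner e e = 1"
  using unit by (simp add: cinner_self)

lemma perp_part_mem: "perp_part e x \<in> perp e"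
  by (simp add: perp_part_def perp_def cinner_simps cinner_unit)

lemma cinner_e_coord: "y \<in> perp e \<Longrightarrow> cinner (\<alpha> *\<^sub>C e + y) e = \<alpha>"
  by (simp add: cinner_simps cinner_perp cinner_unit)

lemma perp_part_coord: "y \<in> perp e \<Longrightarrow> perp_part e (\<alpha> *\<^sub>C e + y) = y"
  by (simp add: perp_part_def cinner_e_coord)

lemma coord_eq_iff:
  "y \<in> perp e \<Longrightarrow> y' \<in> perp e \<Longrightarrow>
    \<alpha> *\<^sub>C e + y = \<beta> *\<^sub>C e + y' \<longleftrightarrow> \<alpha> = \<beta> \<and> y = y'"
  by (metis cinner_e_coord perp_part_coord)

text \<open>Forms, block matrices and D become explicit formulas in the triple (\<alpha>, y, z);
  identities between them are checked in these coordinates.\<close>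

lemma coord_cases:
  obtains \<alpha> y z where "v = (\<alpha> *\<^sub>C e + y, z)" "y \<in> perp e"
  by (metis e_perp_decomp perp_part_mem surj_pair)

lemma form_A_hat_coord:
  "y \<in> perp e \<Longrightarrow> y' \<in> perp e \<Longrightarrow>
    form_A_hat e (\<alpha> *\<^sub>C e + y, z) (\<beta> *\<^sub>C e + y', w) = - z * cnj \<beta> - \<alpha> * cnj w + cinner y y'"
  by (simp add: cinner_e_coord perp_part_coord)

lemma upper_block_coord:
  "y \<in> perp e \<Longrightarrow> upper_block e p f q U b r (\<alpha> *\<^sub>C e + y, z) =
    ((p * \<alpha> + f y + q * z) *\<^sub>C e + (U y + z *\<^sub>C b), r * z)"
  by (simp add: upper_block_def cinner_e_coord perp_part_coord)

lemma norm_coord: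
  "y \<in> perp e \<Longrightarrow> (norm (\<alpha> *\<^sub>C e + y))\<^sup>2 = (cmod \<alpha>)\<^sup>2 + (norm y)\<^sup>2"
proof -
  assume y: "y \<in> perp e"
  have "complex_of_real ((norm (\<alpha> *\<^sub>C e + y))\<^sup>2) = complex_of_real ((cmod \<alpha>)\<^sup>2 + (norm y)\<^sup>2)"
    unfolding cinner_self[symmetric] of_real_add
    by (simp add: cinner_simps cinner_perp[OF y] cinner_unit cinner_complex_def)
  then show ?thesis by (simp only: of_real_eq_iff)
qed

text \<open>By Pythagoras. It makes U composed with the projection a norm-nonincreasing map of the
  whole space.\<close>

lemma norm_perp_part_le: "norm (perp_part e x) \<le> norm x"
proof -
  have "(norm x)\<^sup>2 = (cmod (cinner x e))\<^sup>2 + (norm (perp_part e x))\<^sup>2"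
    using norm_coord[OF perp_part_mem, of "cinner x e" x] by (simp flip: e_perp_decomp)
  then show ?thesis by (simp add: power2_le_imp_le)
qed

section \<open>The operator D as an isometry carrying one form to the other\<close>

lemma D_op_coord:
  "y \<in> perp e \<Longrightarrow> D_op e (\<alpha> *\<^sub>C e + y, z) =
    (((\<alpha> - z) / sqrt 2) *\<^sub>C e + y, (\<alpha> + z) / sqrt 2)"
  by (simp add: D_op_def cinner_e_coord perp_part_coord)

lemma form_A_coord:
  "y \<in> perp e \<Longrightarrow> y' \<in> perp e \<Longrightarrow>
    form_A (\<alpha> *\<^sub>C e + y, z) (\<beta> *\<^sub>C e + y', w) = \<alpha> * cnj \<beta> - z * cnj w + cinner y y'"
  by (simp add: cinner_simps cinner_unit cinner_perp)

lemma sqrt2_mult: "complex_of_real (sqrt 2) * complex_of_real (sqrt 2) = 2"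
  by (simp flip: of_real_mult)

text \<open>On the coordinates outside the orthogonal complement of e, expanding half of (\<alpha> -
  z) cnj(\<beta> - w) - (\<alpha> + z) cnj(\<beta> + w) leaves exactly the cross terms - z cnj
  \<beta> - \<alpha> cnj w.\<close>

lemma form_A_D_op: "form_A (D_op e u) (D_op e v) = form_A_hat e u v"
proof -
  obtain \<alpha> y z where u: "u = (\<alpha> *\<^sub>C e + y, z)" "y \<in> perp e" by (rule coord_cases)
  obtain \<beta> x w where v: "v = (\<beta> *\<^sub>C e + x, w)" "x \<in> perp e" by (rule coord_cases)
  show ?thesis
    unfolding u(1) v(1) D_op_coord[OF u(2)] D_op_coord[OF v(2)]
      form_A_coord[OF u(2) v(2)] form_A_hat_coord[OF u(2) v(2)]
    by (simp add: sqrt2_mult field_simps)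
qed

lemma D_op_add: "D_op e (u + v) = D_op e u + D_op e v"
  by (cases u; cases v)
    (simp add: D_op_def perp_part_def cinner_simps add_divide_distrib diff_divide_distrib
      scaleC_add_left scaleC_diff_left algebra_simps)

lemma D_op_scaleC: "D_op e (c *\<^sub>C v) = c *\<^sub>C D_op e v"
  by (cases v)
    (simp add: D_op_def perp_part_def cinner_simps scaleC_prod_def scaleC_complex_def
      add_divide_distrib diff_divide_distrib scaleC_add_right scaleC_diff_right
      scaleC_add_left scaleC_diff_left scaleC_scaleC algebra_simps)

text \<open>The middle component is untouched, and on the other two coordinates this is the
  parallelogram law in the complex plane.\<close>

lemma norm_D_op: "norm (D_op e v) = norm v"
proof -
  obtain \<alpha> y z where v: "v = (\<alpha> *\<^sub>C e + y, z)" "y \<in> perp e" by (rule coord_cases)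
  have "(cmod ((\<alpha> - z) / sqrt 2))\<^sup>2 + (cmod ((\<alpha> + z) / sqrt 2))\<^sup>2 = (cmod \<alpha>)\<^sup>2 + (cmod z)\<^sup>2"
    unfolding norm_divide power_divide norm_of_real by (simp add: cmod_power2) (simp add: power2_eq_square field_simps)
  then show ?thesis
    unfolding v(1) D_op_coord[OF v(2)] norm_prod_def
    by (simp add: norm_coord[OF v(2)])
qed

lemma D_op_inv [simp]: "D_op e (inv (D_op e) v) = v" "inv (D_op e) (D_op e v) = v"
  using bij_D_op[OF unit] by (simp_all add: bij_is_surj bij_is_inj surj_f_inv_f inv_f_f)

text \<open>D and its inverse preserve the norm, so boundedness survives conjugation, and
  \<open>form_A_D_op\<close> transports the invariance. This gives S an action on the closed
  ball.\<close>

lemma conj_D_op_mem_G: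
  assumes S: "S \<in> G_hat e"
  shows "D_op e \<circ> S \<circ> inv (D_op e) \<in> G"
proof -
  let ?D = "D_op e" and ?E = "inv (D_op e)"
  have E_add: "?E (u + v) = ?E u + ?E v" for u v
    by (metis D_op_add D_op_inv)
  have E_scaleC: "?E (c *\<^sub>C v) = c *\<^sub>C ?E v" for c v
    by (metis D_op_scaleC D_op_inv)
  have E_norm: "norm (?E v) = norm v" for v
    by (metis norm_D_op D_op_inv(1))
  have D: "bounded_linear ?D"
    by (rule bounded_linear_intro[where K=1])
      (simp_all add: D_op_add D_op_scaleC scaleR_scaleC norm_D_op)
  have E: "bounded_linear ?E"
    by (rule bounded_linear_intro[where K=1])
      (simp_all add: E_add E_scaleC scaleR_scaleC E_norm)
  have S1: "bij S" "bounded_linear S" "\<And>c v. S (c *\<^sub>C v) = c *\<^sub>C S v"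
    "\<And>u v. form_A_hat e (S u) (S v) = form_A_hat e u v"
    using S by (auto simp: G_hat_def preserving_group_def bounded_clinear_def)
  have "bounded_linear (?D \<circ> S \<circ> ?E)"
    using bounded_linear_compose[OF D bounded_linear_compose[OF S1(2) E]] by (simp add: o_def)
  moreover have "bij (?D \<circ> S \<circ> ?E)"
    by (intro bij_comp bij_imp_bij_inv bij_D_op unit S1(1))
  moreover have "form_A (?D (S (?E u))) (?D (S (?E v))) = form_A u v" for u v
    by (metis form_A_D_op S1(4) D_op_inv(1))
  ultimately show ?thesis
    by (simp add: G_def preserving_group_def bounded_clinear_def S1(3) E_scaleC D_op_scaleC)
qed

end

section \<open>Fixed points in the closed ball\<close>

text \<open>If the last coordinate vanished, invariance of the form would give |y|^2 = |x|^2 - 1 <=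
  0, hence T (x, 1) = 0, against injectivity. So the \<open>inverse\<close> in
  \<open>ball_action\<close> is never taken at 0 on the closed ball.\<close>

lemma G_snd_nonzero:
  assumes T: "T \<in> G" and x: "norm x \<le> 1"
  shows "snd (T (x, 1)) \<noteq> 0"
proof
  assume 0: "snd (T (x, 1)) = 0"
  obtain y w where yw: "T (x, 1) = (y, w)" by (cases "T (x, 1)")
  have T': "bij T" "bounded_linear T" "\<And>u v. form_A (T u) (T v) = form_A u v"
    using T by (auto simp: G_def preserving_group_def bounded_clinear_def)
  have "complex_of_real ((norm y)\<^sup>2) = complex_of_real ((norm x)\<^sup>2 - 1)"
    using T'(3)[of "(x, 1)" "(x, 1)"] yw 0 by (simp add: cinner_self)
  then have "(norm y)\<^sup>2 = (norm x)\<^sup>2 - 1" by (simp only: of_real_eq_iff)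
  moreover have "(norm x)\<^sup>2 \<le> 1" using x by (simp add: power_le_one)
  ultimately have "(norm y)\<^sup>2 \<le> 0" by simp
  then have "y = 0" by simp
  then have "T (x, 1) = T 0"
    using yw 0 linear_0[OF bounded_linear.linear[OF T'(2)]] by (simp add: zero_prod_def)
  then have "(x, 1::complex) = 0" using T'(1) by (metis bij_is_inj injD)
  then show False by (simp add: zero_prod_def)
qed

lemma ball_action_fixed_iff:
  assumes T: "T \<in> G" and x: "norm x \<le> 1"
  shows "ball_action T x = x \<longleftrightarrow> (\<exists>c. T (x, 1) = c *\<^sub>C (x, 1))"
proof -
  obtain y w where yw: "T (x, 1) = (y, w)" by (cases "T (x, 1)")
  have w: "w \<noteq> 0" using G_snd_nonzero[OF T x] yw by simp
  have "inverse w *\<^sub>C y = x \<longleftrightarrow> y = w *\<^sub>C x"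
    using scaleC_left_cancel[OF w, of "inverse w *\<^sub>C y" x] w by (simp add: scaleC_scaleC)
  then show ?thesis
    by (auto simp: ball_action_def yw scaleC_prod_def scaleC_complex_def)
qed

text \<open>The sign of the form at a vector thus tells whether its normalized point is inside the
  ball, on the sphere or outside.\<close>

lemma form_A_normalize:
  assumes "w \<noteq> 0"
  shows "form_A (y, w) (y, w) =
    complex_of_real ((cmod w)\<^sup>2 * ((norm (inverse w *\<^sub>C y))\<^sup>2 - 1))"
proof -
  have "(cmod w)\<^sup>2 * ((norm (inverse w *\<^sub>C y))\<^sup>2 - 1) = (norm y)\<^sup>2 - (cmod w)\<^sup>2"
    using assms by (simp add: norm_scaleC norm_inverse power_mult_distrib right_diff_distrib
      flip: mult.assoc power_mult_distrib)
  moreover have "form_A (y, w) (y, w) = complex_of_real ((norm y)\<^sup>2 - (cmod w)\<^sup>2)"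
    by (simp add: cinner_self flip: complex_norm_square)
  ultimately show ?thesis by simp
qed

text \<open>A nonzero vector with nonpositive form cannot have last coordinate 0, since the form
  would then be |y|^2 > 0. It can therefore be rescaled to (x, 1); the last equation separates
  interior from boundary points.\<close>

lemma eigenvector_fixed_point:
  assumes T: "T \<in> G" and eig: "T v = k *\<^sub>C v" and v: "v \<noteq> 0" and neg: "Re (form_A v v) \<le> 0"
  obtains x w where "v = w *\<^sub>C (x, 1)" "w \<noteq> 0" "norm x \<le> 1" "ball_action T x = x"
    "Re (form_A v v) = (cmod w)\<^sup>2 * ((norm x)\<^sup>2 - 1)"
proof -
  obtain y w where yw: "v = (y, w)" by (cases v)
  have w: "w \<noteq> 0"
  proof
    assume "w = 0"
    with neg yw have "y = 0" by (simp add: cinner_self del: of_real_power)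
    with v yw \<open>w = 0\<close> show False by (simp add: zero_prod_def)
  qed
  define x where "x = inverse w *\<^sub>C y"
  have vx: "v = w *\<^sub>C (x, 1)"
    using w by (simp add: yw x_def scaleC_prod_def scaleC_scaleC scaleC_complex_def)
  have val: "Re (form_A v v) = (cmod w)\<^sup>2 * ((norm x)\<^sup>2 - 1)"
    by (simp only: yw form_A_normalize[OF w] x_def Re_complex_of_real)
  have "(norm x)\<^sup>2 - 1 \<le> 0"
    using neg w unfolding val by (simp add: mult_le_0_iff)
  then have x1: "norm x \<le> 1" by (simp add: power_le_one_iff)
  have scaleT: "T (c *\<^sub>C u) = c *\<^sub>C T u" for c u
    using T unfolding G_def preserving_group_def bounded_clinear_def by blast
  have "w *\<^sub>C T (x, 1) = w *\<^sub>C (k *\<^sub>C (x, 1))"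
    using eig unfolding vx scaleT scaleC_scaleC by (simp add: mult.commute)
  then have "T (x, 1) = k *\<^sub>C (x, 1)" by (simp add: scaleC_left_cancel[OF w])
  then have "ball_action T x = x" using ball_action_fixed_iff[OF T x1] by blast
  with that vx w x1 val show ?thesis by blast
qed

section \<open>The stabilizer of infinity\<close>

text \<open>The bottom right entry \<open>\<mu>\<close> determines the top left one, and the top middle entry is
  written as \<open>\<langle>U y, b\<rangle>\<close> instead of \<open>\<langle>y, U\<^sup>-\<^sup>1 b\<rangle>\<close>.\<close>

definition stabilizer_form ::
  "'a::complex_inner \<Rightarrow> complex \<Rightarrow> ('a \<Rightarrow> 'a) \<Rightarrow> 'a \<Rightarrow> complex \<Rightarrow>
   ('a \<times> complex \<Rightarrow> 'a \<times> complex) \<Rightarrow> bool"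
  where "stabilizer_form e \<mu> U b t S \<longleftrightarrow>
    \<mu> \<noteq> 0 \<and> unitary_on (perp e) U \<and> b \<in> perp e \<and> Re t = (norm b)\<^sup>2 / 2 \<and>
    (\<forall>\<alpha> y z. y \<in> perp e \<longrightarrow> S (\<alpha> *\<^sub>C e + y, z) =
      ((inverse (cnj \<mu>) * \<alpha> + cinner (U y) b + \<mu> * t * z) *\<^sub>C e + (U y + z *\<^sub>C \<mu> *\<^sub>C b), \<mu> * z))"

text \<open>This is how |\<mu>| = 1 enters the computations: the two corner entries on the diagonal
  of the block matrix coincide.\<close>

lemma inverse_cnj_eq_iff: "\<mu> \<noteq> 0 \<Longrightarrow> inverse (cnj \<mu>) = \<mu> \<longleftrightarrow> cmod \<mu> = 1"
proof -
  assume "\<mu> \<noteq> 0"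
  then have "inverse (cnj \<mu>) = \<mu> \<longleftrightarrow> \<mu> * cnj \<mu> = 1"
    by (auto simp: field_simps)
  also have "\<dots> \<longleftrightarrow> complex_of_real ((cmod \<mu>)\<^sup>2) = complex_of_real 1"
    by (simp only: complex_norm_square of_real_1)
  also have "\<dots> \<longleftrightarrow> cmod \<mu> = 1"
    by (simp only: of_real_eq_iff) (simp add: power2_eq_1_iff, smt (verit) norm_ge_zero)
  finally show ?thesis .
qed

lemma G_hatD:
  assumes "S \<in> G_hat e"
  shows "bij S" "S (u + v) = S u + S v" "S (c *\<^sub>C v) = c *\<^sub>C S v"
    "form_A_hat e (S u) (S v) = form_A_hat e u v"
  using assms unfolding G_hat_def preserving_group_def bounded_clinear_def
  by (blast intro: linear_add bounded_linear.linear)+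

context
  fixes e :: "'a::complex_inner"
  assumes unit: "norm e = 1"
begin

text \<open>Pairing with (e, 0) reads off minus the last coordinate, so invariance makes S multiply
  the last coordinate by a fixed \<mu>. Invariance on the orthogonal complement of e and on (0, 1)
  then determines the remaining entries.\<close>

lemma G_hat_infinity_stabilizer_form:
  assumes S: "S \<in> G_hat_infinity e"
  shows "\<exists>\<mu> U b t. stabilizer_form e \<mu> U b t S"
proof -
  obtain c where SG: "S \<in> G_hat e" and Se: "S (e, 0) = c *\<^sub>C (e, 0)"
    using S by (auto simp: G_hat_infinity_def)
  note S = G_hatD[OF SG]
  note form = form_A_hat_coord[OF unit]
  have form_e: "form_A_hat e u (k *\<^sub>C (e, 0)) = - snd u * cnj k" for u k
  proof -
    obtain \<alpha> y z where "u = (\<alpha> *\<^sub>C e + y, z)" "y \<in> perp e" by (rule coord_cases[OF unit])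
    then show ?thesis
      using form[OF _ perp_0, of y \<alpha> z k 0] by (simp add: scaleC_prod_def scaleC_complex_def)
  qed
  have snd_S: "snd (S u) * cnj c = snd u" for u
    using S(4)[of u "(e, 0)"] form_e[of "S u" c] form_e[of u 1] Se by simp
  have c: "c \<noteq> 0" using snd_S[of "(0, 1)"] by auto
  define \<mu> where "\<mu> = inverse (cnj c)"
  have \<mu>: "\<mu> \<noteq> 0" and c\<mu>: "inverse (cnj \<mu>) = c" using c by (auto simp: \<mu>_def)
  have snd_S: "snd (S u) = \<mu> * snd u" for u
    using snd_S[of u] c by (auto simp: \<mu>_def field_simps)
  define U where "U = (\<lambda>x. perp_part e (fst (S (x, 0))))"
  define f where "f = (\<lambda>x. cinner (fst (S (x, 0))) e)"
  \<comment> \<open>\<open>stabilizer_form\<close> has entries \<mu> b and \<mu> t, so the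
    components of S (0, 1) are divided by \<mu>.\<close>
  define b where "b = inverse \<mu> *\<^sub>C perp_part e (fst (S (0, 1)))"
  define t where "t = inverse \<mu> * cinner (fst (S (0, 1))) e"
  have U_mem: "U x \<in> perp e" for x by (simp add: U_def perp_part_mem[OF unit])
  have b_mem: "b \<in> perp e" by (simp add: b_def perp_scaleC perp_part_mem[OF unit])
  have S_x: "S (x, 0) = (f x *\<^sub>C e + U x, 0)" for x
    using snd_S[of "(x, 0)"] e_perp_decomp[of "fst (S (x, 0))" e]
    by (simp add: prod_eq_iff f_def U_def)
  have S_1: "S (0, 1) = ((\<mu> * t) *\<^sub>C e + \<mu> *\<^sub>C b, \<mu>)"
    using snd_S[of "(0, 1)"] e_perp_decomp[of "fst (S (0, 1))" e] \<mu>
    by (simp add: prod_eq_iff t_def b_def scaleC_scaleC flip: mult.assoc)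
  have \<mu>b: "\<mu> *\<^sub>C b \<in> perp e" by (simp add: b_mem perp_scaleC)
  \<comment> \<open>Vectors (x, 0) with x orthogonal to e pair to 0 with (0, 1); the same relation
    between their images fixes the top middle entry.\<close>
  have f: "f x = cinner (U x) b" if "x \<in> perp e" for x
  proof -
    have "form_A_hat e (x, 0) (0, 1) = 0"
      using form[OF that perp_0, of 0 0 0 1] by simp
    then have "- f x * cnj \<mu> + cinner (U x) (\<mu> *\<^sub>C b) = 0"
      using S(4)[of "(x, 0)" "(0, 1)"] unfolding S_x S_1 form[OF U_mem \<mu>b] by simp
    then show ?thesis using \<mu> by (simp add: cinner_simps)
  qed
  have U_add: "U (x + y) = U x + U y" for x y
    using S(2)[of "(x, 0)" "(y, 0)"]
    by (simp add: U_def perp_part_def cinner_simps scaleC_add_left)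
  have U_scaleC: "U (k *\<^sub>C x) = k *\<^sub>C U x" for k x
    using S(3)[of k "(x, 0)"]
    by (simp add: U_def perp_part_def cinner_simps scaleC_diff_right scaleC_scaleC
        scaleC_prod_def)
  have U_cinner: "cinner (U x) (U y) = cinner x y" if "x \<in> perp e" "y \<in> perp e" for x y
    using S(4)[of "(x, 0)" "(y, 0)"] form[OF that, of 0 0 0 0]
    unfolding S_x form[OF U_mem U_mem] by simp
  have S_coord: "S (\<alpha> *\<^sub>C e + y, z) =
      ((c * \<alpha> + cinner (U y) b + \<mu> * t * z) *\<^sub>C e + (U y + z *\<^sub>C \<mu> *\<^sub>C b), \<mu> * z)"
    if "y \<in> perp e" for \<alpha> y z
  proof -
    have "(\<alpha> *\<^sub>C e + y, z) = \<alpha> *\<^sub>C (e, 0) + (y, 0) + z *\<^sub>C (0, 1)"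
      by (simp add: scaleC_prod_def scaleC_complex_def)
    also have "S \<dots> = \<alpha> *\<^sub>C c *\<^sub>C (e, 0) + (f y *\<^sub>C e + U y, 0) + z *\<^sub>C ((\<mu> * t) *\<^sub>C e + \<mu> *\<^sub>C b, \<mu>)"
      by (simp only: S(2,3) Se S_1) (simp only: S_x)
    finally show ?thesis
      by (simp add: f[OF that] scaleC_prod_def scaleC_complex_def scaleC_scaleC scaleC_add_left
          scaleC_add_right algebra_simps)
  qed
  have "inj_on U (perp e)"
  proof (rule inj_onI)
    fix x y assume xy: "x \<in> perp e" "y \<in> perp e" "U x = U y"
    have "U (x - y) = 0" using U_add[of "x - y" y] xy by simp
    then show "x = y"
      using U_cinner[of "x - y" "x - y"] xy by (simp add: perp_intros cinner_self)
  qed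
  \<comment> \<open>An S-preimage of (y, 0) has last coordinate 0, so its component orthogonal to e
    is sent to y by U.\<close>
  moreover have "y \<in> U ` perp e" if y: "y \<in> perp e" for y
  proof -
    obtain v where v: "S v = (y, 0)" using S(1) by (metis bij_is_surj surjD)
    obtain \<alpha> x z where vx: "v = (\<alpha> *\<^sub>C e + x, z)" "x \<in> perp e" by (rule coord_cases[OF unit])
    have "z = 0" using snd_S[of v] v vx \<mu> by simp
    then have "(c * \<alpha> + cinner (U x) b) *\<^sub>C e + U x = 0 *\<^sub>C e + y"
      using v S_coord[OF vx(2), of \<alpha> z] vx(1) by simp
    then have "U x = y" unfolding coord_eq_iff[OF unit U_mem y] by simp
    then show ?thesis using vx(2) by blast
  qed
  ultimately have "bij_betw U (perp e) (perp e)"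
    using U_mem by (auto simp: bij_betw_def)
  then have "unitary_on (perp e) U"
    by (simp add: unitary_on_def U_add U_scaleC U_cinner)
  \<comment> \<open>The vector (0, 1) is isotropic, hence so is its image.\<close>
  moreover have "Re t = (norm b)\<^sup>2 / 2"
  proof -
    have "form_A_hat e (0, 1) (0, 1) = 0"
      using form[OF perp_0 perp_0, of 0 1 0 1] by simp
    then have "- \<mu> * cnj (\<mu> * t) - \<mu> * t * cnj \<mu> + cinner (\<mu> *\<^sub>C b) (\<mu> *\<^sub>C b) = 0"
      using S(4)[of "(0, 1)" "(0, 1)"] unfolding S_1 form[OF \<mu>b \<mu>b] by simp
    then have "\<mu> * cnj \<mu> * (cinner b b - (t + cnj t)) = 0"
      by (simp add: cinner_simps algebra_simps)
    then have "complex_of_real ((norm b)\<^sup>2) = complex_of_real (2 * Re t)"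
      using \<mu> by (simp add: cinner_self complex_add_cnj)
    then show ?thesis by (simp only: of_real_eq_iff)
  qed
  ultimately have "stabilizer_form e \<mu> U b t S"
    unfolding stabilizer_form_def c\<mu> using \<mu> b_mem S_coord by blast
  then show ?thesis by blast
qed

section \<open>Commutation with a Heisenberg translation\<close>

lemma heisenberg_coord:
  assumes "a \<in> perp e" "y \<in> perp e"
  shows "heisenberg e lam a s (\<alpha> *\<^sub>C e + y, z) =
    ((lam * (\<alpha> + cinner y a + s * z)) *\<^sub>C e + lam *\<^sub>C (y + z *\<^sub>C a), lam * z)"
  using assms(2)
  by (simp add: heisenberg_def upper_block_coord[OF unit] scaleC_prod_def scaleC_complex_def
      scaleC_add_right scaleC_scaleC)

lemma commute_heisenberg_iff:
  assumes S: "stabilizer_form e \<mu> U b t S" and lam: "lam \<noteq> 0" and a: "a \<in> perp e"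
  shows "S \<circ> heisenberg e lam a s = heisenberg e lam a s \<circ> S \<longleftrightarrow>
    U a = \<mu> *\<^sub>C a \<and> (\<forall>y\<in>perp e. inverse (cnj \<mu>) * cinner y a = cinner (U y) a) \<and>
    inverse (cnj \<mu>) * s + cinner (U a) b = \<mu> * (cinner b a + s)"
proof -
  define c where "c = inverse (cnj \<mu>)"
  have \<mu>: "\<mu> \<noteq> 0" and U: "unitary_on (perp e) U" and b: "b \<in> perp e"
    using S by (auto simp: stabilizer_form_def)
  have S_coord: "S (\<alpha> *\<^sub>C e + y, z) =
      ((c * \<alpha> + cinner (U y) b + \<mu> * t * z) *\<^sub>C e + (U y + z *\<^sub>C \<mu> *\<^sub>C b), \<mu> * z)"
    if "y \<in> perp e" for \<alpha> y z
    using S that by (simp add: stabilizer_form_def c_def)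
  note mem = unitary_on_mem[OF U] a b perp_intros
  have U0: "U 0 = 0" using unitary_on_scaleC[OF U perp_0, of 0] by simp
  \<comment> \<open>After cancelling the nonzero scalar \<open>lam\<close>, the terms in \<alpha>, t
    and \<mu> b agree on both sides; only the terms involving a and s remain.\<close>
  have pointwise: "S (heisenberg e lam a s (\<alpha> *\<^sub>C e + y, z)) =
      heisenberg e lam a s (S (\<alpha> *\<^sub>C e + y, z)) \<longleftrightarrow>
    c * cinner y a + z * (c * s + cinner (U a) b) =
      cinner (U y) a + z * (\<mu> * (cinner b a + s)) \<and> z *\<^sub>C U a = z *\<^sub>C \<mu> *\<^sub>C a"
    if y: "y \<in> perp e" for \<alpha> y z
  proof -
    have "S (heisenberg e lam a s (\<alpha> *\<^sub>C e + y, z)) =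
      ((lam * (c * \<alpha> + c * cinner y a + c * s * z + cinner (U y) b + z * cinner (U a) b + \<mu> * t * z)) *\<^sub>C e
        + lam *\<^sub>C (U y + z *\<^sub>C U a + z *\<^sub>C \<mu> *\<^sub>C b), lam * (\<mu> * z))"
    proof -
      have "lam *\<^sub>C (y + z *\<^sub>C a) \<in> perp e" using y by (simp add: mem)
      from S_coord[OF this] show ?thesis
        unfolding heisenberg_coord[OF a y] using y
        by (simp add: mem unitary_on_add[OF U] unitary_on_scaleC[OF U] cinner_simps
            scaleC_add_right scaleC_scaleC) (simp add: algebra_simps)
    qed
    moreover have "heisenberg e lam a s (S (\<alpha> *\<^sub>C e + y, z)) =
      ((lam * (c * \<alpha> + cinner (U y) b + \<mu> * t * z + cinner (U y) a + z * \<mu> * cinner b a + s * \<mu> * z)) *\<^sub>C e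
        + lam *\<^sub>C (U y + z *\<^sub>C \<mu> *\<^sub>C b + z *\<^sub>C \<mu> *\<^sub>C a), lam * (\<mu> * z))"
    proof -
      have "U y + z *\<^sub>C \<mu> *\<^sub>C b \<in> perp e" using y by (simp add: mem)
      from heisenberg_coord[OF a this] show ?thesis
        unfolding S_coord[OF y]
        by (simp add: cinner_simps scaleC_add_right scaleC_scaleC) (simp add: algebra_simps)
    qed
    ultimately show ?thesis
      using y lam by (simp add: coord_eq_iff[OF unit] mem scaleC_left_cancel)
        (auto simp: algebra_simps)
  qed
  have "S \<circ> heisenberg e lam a s = heisenberg e lam a s \<circ> S \<longleftrightarrow>
    (\<forall>\<alpha> y z. y \<in> perp e \<longrightarrow> S (heisenberg e lam a s (\<alpha> *\<^sub>C e + y, z)) =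
      heisenberg e lam a s (S (\<alpha> *\<^sub>C e + y, z)))"
    unfolding fun_eq_iff o_apply by (metis coord_cases[OF unit])
  also have "\<dots> \<longleftrightarrow> (\<forall>y z. y \<in> perp e \<longrightarrow>
    c * cinner y a + z * (c * s + cinner (U a) b) =
      cinner (U y) a + z * (\<mu> * (cinner b a + s)) \<and> z *\<^sub>C U a = z *\<^sub>C \<mu> *\<^sub>C a)"
    (is "_ \<longleftrightarrow> ?P")
    using pointwise by blast
  also have "\<dots> \<longleftrightarrow> U a = \<mu> *\<^sub>C a \<and> (\<forall>y\<in>perp e. c * cinner y a = cinner (U y) a) \<and>
    c * s + cinner (U a) b = \<mu> * (cinner b a + s)" (is "_ \<longleftrightarrow> ?Q")
  proof
    assume P: ?P
    \<comment> \<open>Taking z = 0 isolates the condition on y; then y = 0 and z = 1 give the other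
      two.\<close>
    have "c * cinner y a = cinner (U y) a" if "y \<in> perp e" for y
      using P[rule_format, OF that, of 0] by simp
    moreover have "c * s + cinner (U a) b = \<mu> * (cinner b a + s) \<and> U a = \<mu> *\<^sub>C a"
      using P[rule_format, OF perp_0, of 1] by (auto simp: U0)
    ultimately show ?Q by blast
  qed auto
  finally show ?thesis unfolding c_def .
qed

text \<open>With \<open>N = \<lambda>\<^sup>-\<^sup>1 T - I\<close>, the line spanned by \<open>(e, 0)\<close> is the range of \<open>N\<close> if
  \<open>a = 0\<close> and of \<open>N\<^sup>2\<close> otherwise, hence invariant under operators commuting with \<open>T\<close>.\<close>

lemma commute_heisenberg_imp_infinity:
  assumes S: "S \<in> G_hat e" and lam: "lam \<noteq> 0" and a: "a \<in> perp e" and s: "s \<noteq> 0"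
    and comm: "S \<circ> heisenberg e lam a s = heisenberg e lam a s \<circ> S"
  shows "S \<in> G_hat_infinity e"
proof -
  note S' = G_hatD[OF S]
  define N where "N = (\<lambda>v. ((cinner (fst v) a + s * snd v) *\<^sub>C e + snd v *\<^sub>C a, 0::complex))"
  have heis: "heisenberg e lam a s v = lam *\<^sub>C (v + N v)" for v
  proof -
    obtain \<alpha> y z where v: "v = (\<alpha> *\<^sub>C e + y, z)" "y \<in> perp e" by (rule coord_cases[OF unit])
    then show ?thesis
      unfolding v(1) heisenberg_coord[OF a v(2)]
      using a cinner_perp(2)[of a] by (simp add: N_def cinner_simps scaleC_prod_def
        scaleC_complex_def scaleC_add_right scaleC_add_left scaleC_scaleC distrib_left
        mult.assoc)
  qed
  have SN: "S (N v) = N (S v)" for v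
    using fun_cong[OF comm, of v] lam by (simp add: heis S'(2,3) scaleC_left_cancel)
  \<comment> \<open>Evaluation at (0, 1) gives k = s if a = 0, and k = \<open>cinner a a\<close>
    otherwise.\<close>
  have "\<exists>k c. k \<noteq> 0 \<and> S (k *\<^sub>C (e, 0)) = c *\<^sub>C (e, 0)"
  proof (cases "a = 0")
    case True
    then have N: "N v = (s * snd v) *\<^sub>C (e, 0)" for v
      by (simp add: N_def scaleC_prod_def scaleC_complex_def)
    show ?thesis using SN[of "(0, 1)"] s unfolding N by auto
  next
    case False
    have N2: "N (N v) = (snd v * cinner a a) *\<^sub>C (e, 0)" for v
      using a by (simp add: N_def scaleC_prod_def scaleC_complex_def cinner_simps cinner_perp)
    have "cinner a a \<noteq> 0" using False by (simp add: cinner_self)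
    then show ?thesis
      using N2[of "(0, 1)"] N2[of "S (0, 1)"] SN by (metis mult_1 snd_conv)
  qed
  then obtain k c where kc: "k \<noteq> 0" "S (k *\<^sub>C (e, 0)) = c *\<^sub>C (e, 0)" by blast
  then have "S (e, 0) = inverse k *\<^sub>C c *\<^sub>C (e, 0)"
    by (metis S'(3) scaleC_scaleC left_inverse scaleC_1_left)
  then have "S (e, 0) = (inverse k * c) *\<^sub>C (e, 0)"
    by (simp only: scaleC_scaleC)
  then show ?thesis using S unfolding G_hat_infinity_def by blast
qed

end

section \<open>Hyperbolic elements of the stabilizer\<close>

text \<open>Banach's fixed point theorem. Since U is meaningful only on the orthogonal complement of
  e, it is composed with the projection to obtain a contraction of the whole space; all values of
  that map, hence its fixed point, lie in the complement.\<close>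

lemma unitary_on_contraction_fixed_point:
  fixes e :: "'a::complex_hilbert_space"
  assumes unit: "norm e = 1" and U: "unitary_on (perp e) U" and k: "cmod k < 1"
    and b: "b \<in> perp e"
  shows "\<exists>d\<in>perp e. d = k *\<^sub>C U d + b"
proof -
  define F where "F = (\<lambda>x. k *\<^sub>C U (perp_part e x) + b)"
  note mem = perp_part_mem[OF unit]
  have F_mem: "F x \<in> perp e" for x
    by (simp add: F_def b perp_intros unitary_on_mem[OF U] mem)
  have "dist (F x) (F y) \<le> cmod k * dist x y" for x y
  proof -
    have pd: "perp_part e (x - y) = perp_part e x - perp_part e y"
      by (simp add: perp_part_def cinner_simps scaleC_diff_left)
    have "F x - F y = k *\<^sub>C U (perp_part e (x - y))"
      unfolding pd unitary_on_diff[OF U mem mem] by (simp add: F_def scaleC_diff_right)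
    then have "norm (F x - F y) = cmod k * norm (perp_part e (x - y))"
      by (simp add: norm_scaleC unitary_on_norm[OF U mem])
    also have "\<dots> \<le> cmod k * norm (x - y)"
      by (intro mult_left_mono norm_perp_part_le[OF unit]) simp
    finally show ?thesis by (simp add: dist_norm)
  qed
  then obtain d where "F d = d"
    using banach_fix_type[of "cmod k" F] k by auto
  then show ?thesis using F_mem[of d] by (intro bexI[of _ d]) (auto simp: F_def perp_part_perp)
qed

text \<open>For |k| < 1 apply the inverse V of U to get d = k V d - V b; for |k| > 1 divide by k.
  Either way d is a fixed point of a contraction.\<close>

lemma unitary_on_resolvent:
  fixes e :: "'a::complex_hilbert_space"
  assumes unit: "norm e = 1" and U: "unitary_on (perp e) U" and k: "cmod k \<noteq> 1" "k \<noteq> 0"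
    and b: "b \<in> perp e"
  shows "\<exists>d\<in>perp e. U d + b = k *\<^sub>C d"
proof (cases "cmod k < 1")
  case True
  let ?V = "inv_into (perp e) U"
  note V = unitary_on_inv[OF U]
  obtain d where d: "d \<in> perp e" "d = k *\<^sub>C ?V d + - ?V b"
    using unitary_on_contraction_fixed_point[OF unit V True, of "- ?V b"] b
    by (auto simp: perp_intros unitary_on_mem[OF V])
  have "d = ?V (k *\<^sub>C d - b)"
    using d b by (simp add: unitary_on_diff[OF V] unitary_on_scaleC[OF V] perp_intros)
  then have "U d = k *\<^sub>C d - b"
    using unitary_on_right_inv[OF U, of "k *\<^sub>C d - b"] d b by (simp add: perp_intros)
  then show ?thesis using d by (intro bexI[of _ d]) auto
next
  case False
  then have "cmod (inverse k) < 1" using k by (simp add: norm_inverse inverse_less_1_iff)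
  then obtain d where d: "d \<in> perp e" "d = inverse k *\<^sub>C U d + inverse k *\<^sub>C b"
    using unitary_on_contraction_fixed_point[OF unit U _ perp_scaleC[OF b]] by blast
  have "k *\<^sub>C d = U d + b"
    by (subst d(2)) (simp add: k scaleC_add_right scaleC_scaleC)
  then show ?thesis using d(1) by metis
qed

section \<open>Fixed points in the closed ball as eigenvectors of S\<close>

lemma G_hat_eigenvector_fixed_point:
  fixes e :: "'a::complex_inner"
  assumes unit: "norm e = 1" and S: "S \<in> G_hat e"
    and eig: "S v = k *\<^sub>C v" and v: "v \<noteq> 0" and neg: "Re (form_A_hat e v v) \<le> 0"
  obtains x w where "D_op e v = w *\<^sub>C (x, 1)" "w \<noteq> 0" "norm x \<le> 1"
    "ball_action (D_op e \<circ> S \<circ> inv (D_op e)) x = x"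
    "Re (form_A_hat e v v) = (cmod w)\<^sup>2 * ((norm x)\<^sup>2 - 1)"
proof (rule eigenvector_fixed_point[OF conj_D_op_mem_G[OF unit S], of "D_op e v" k])
  show "(D_op e \<circ> S \<circ> inv (D_op e)) (D_op e v) = k *\<^sub>C D_op e v"
    by (simp add: eig D_op_inv[OF unit] D_op_scaleC[OF unit])
  show "D_op e v \<noteq> 0"
    using v norm_D_op[OF unit, of v] by auto
  show "Re (form_A (D_op e v) (D_op e v)) \<le> 0"
    using neg by (simp only: form_A_D_op[OF unit])
qed (use that form_A_D_op[OF unit] in metis)

lemma G_hat_fixed_point_eigenvector:
  fixes e :: "'a::complex_inner"
  assumes unit: "norm e = 1" and S: "S \<in> G_hat e" and x: "norm x \<le> 1"
    and fixed: "ball_action (D_op e \<circ> S \<circ> inv (D_op e)) x = x"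
  obtains v k where "D_op e v = (x, 1)" "S v = k *\<^sub>C v"
    "Re (form_A_hat e v v) = (norm x)\<^sup>2 - 1"
proof -
  obtain k where k: "(D_op e \<circ> S \<circ> inv (D_op e)) (x, 1) = k *\<^sub>C (x, 1)"
    using fixed ball_action_fixed_iff[OF conj_D_op_mem_G[OF unit S] x] by blast
  define v where "v = inv (D_op e) (x, 1)"
  have Dv: "D_op e v = (x, 1)" by (simp add: v_def D_op_inv[OF unit])
  have "D_op e (S v) = D_op e (k *\<^sub>C v)"
    using k by (simp add: D_op_scaleC[OF unit] Dv flip: v_def)
  then have "S v = k *\<^sub>C v"
    by (metis D_op_inv(2)[OF unit])
  moreover have "Re (form_A_hat e v v) = (norm x)\<^sup>2 - 1"
    unfolding form_A_D_op[OF unit, symmetric] Dv by (simp add: cinner_self del: of_real_power)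
  ultimately show ?thesis using that Dv by blast
qed

lemma scaleC_pair_1_eq_iff:
  "w *\<^sub>C (x, 1) = w' *\<^sub>C (y, 1::complex) \<longleftrightarrow> w = w' \<and> (w = 0 \<or> x = (y::'a::complex_vector))"
  by (cases "w = 0") (auto simp: scaleC_prod_def scaleC_complex_def scaleC_left_cancel)

text \<open>Take an eigenvector v over x. If its last coordinate were 0, its form would be |y|^2 and
  also |x|^2 - 1 <= 0, so y = 0 and v would lie on the line of (e, 0), that is x = e. Otherwise v is
  rescaled to last coordinate 1, and comparing last coordinates forces the eigenvalue \<mu>.\<close>

lemma stabilizer_form_fixed_point_cases:
  fixes e :: "'a::complex_inner"
  assumes unit: "norm e = 1" and S: "S \<in> G_hat e" and form: "stabilizer_form e \<mu> U b t S"
    and x: "norm x \<le> 1" "x \<noteq> e"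
    and fixed: "ball_action (D_op e \<circ> S \<circ> inv (D_op e)) x = x"
  obtains \<alpha> y z where "y \<in> perp e" "z \<noteq> 0" "(x, 1) = z *\<^sub>C D_op e (\<alpha> *\<^sub>C e + y, 1)"
    "S (\<alpha> *\<^sub>C e + y, 1) = \<mu> *\<^sub>C (\<alpha> *\<^sub>C e + y, 1)"
    "Re (form_A_hat e (\<alpha> *\<^sub>C e + y, 1) (\<alpha> *\<^sub>C e + y, 1)) = ((norm x)\<^sup>2 - 1) / (cmod z)\<^sup>2"
proof -
  obtain v k where v: "D_op e v = (x, 1)" "S v = k *\<^sub>C v"
    "Re (form_A_hat e v v) = (norm x)\<^sup>2 - 1"
    by (rule G_hat_fixed_point_eigenvector[OF unit S x(1) fixed])
  obtain \<alpha> y z where co: "v = (\<alpha> *\<^sub>C e + y, z)" "y \<in> perp e" by (rule coord_cases[OF unit])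
  note fc = form_A_hat_coord[OF unit co(2) co(2)]
  have z: "z \<noteq> 0"
  proof
    assume z: "z = 0"
    have "(norm y)\<^sup>2 = (norm x)\<^sup>2 - 1"
      using v(3) unfolding co(1) fc z by (simp add: cinner_self del: of_real_power)
    moreover have "(norm x)\<^sup>2 \<le> 1" using x(1) by (simp add: power_le_one)
    ultimately have "(norm y)\<^sup>2 \<le> 0" by simp
    then have "y = 0" by simp
    then have "v = \<alpha> *\<^sub>C (e, 0)" using co z by (simp add: scaleC_prod_def scaleC_complex_def)
    then have "1 *\<^sub>C (x, 1) = (\<alpha> * complex_of_real (1 / sqrt 2)) *\<^sub>C (e, 1::complex)"
      using v(1) by (simp only: D_op_scaleC[OF unit] D_op_e[OF unit] scaleC_scaleC scaleC_1_left)
    then show False unfolding scaleC_pair_1_eq_iff using x(2) by simp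
  qed
  define \<beta> x' where "\<beta> = inverse z * \<alpha>" and "x' = inverse z *\<^sub>C y"
  define v' where "v' = (\<beta> *\<^sub>C e + x', 1::complex)"
  have x': "x' \<in> perp e" by (simp add: x'_def perp_scaleC co)
  have vv': "v = z *\<^sub>C v'"
    using z by (simp add: v'_def \<beta>_def x'_def co(1) scaleC_prod_def scaleC_complex_def
        scaleC_add_right scaleC_scaleC flip: mult.assoc)
  have "z *\<^sub>C S v' = z *\<^sub>C k *\<^sub>C v'"
    using v(2) unfolding vv' G_hatD(3)[OF S] scaleC_scaleC by (simp add: mult.commute)
  then have eig: "S v' = k *\<^sub>C v'" by (simp only: scaleC_left_cancel[OF z])
  moreover have "snd (S v') = \<mu>"
    using form x' by (simp add: stabilizer_form_def v'_def)
  ultimately have "k = \<mu>" by (simp add: v'_def scaleC_prod_def scaleC_complex_def)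
  have "form_A_hat e v v = z * cnj z * form_A_hat e v' v'"
  proof -
    have "v = ((z * \<beta>) *\<^sub>C e + z *\<^sub>C x', z)"
      by (simp add: vv' v'_def scaleC_prod_def scaleC_complex_def scaleC_add_right scaleC_scaleC)
    then show ?thesis
      unfolding v'_def
      by (simp only: form_A_hat_coord[OF unit] x' perp_scaleC)
        (simp add: cinner_simps algebra_simps)
  qed
  then have "form_A_hat e v v = complex_of_real ((cmod z)\<^sup>2) * form_A_hat e v' v'"
    by (simp only: complex_norm_square)
  then have "Re (form_A_hat e v v) = (cmod z)\<^sup>2 * Re (form_A_hat e v' v')"
    by (simp only: Re_complex_of_real times_complex.sel Im_complex_of_real mult_zero_left diff_zero)
  then have "Re (form_A_hat e v' v') = ((norm x)\<^sup>2 - 1) / (cmod z)\<^sup>2"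
    using v(3) z by (simp add: field_simps)
  moreover have "(x, 1) = z *\<^sub>C D_op e v'"
    using v(1) unfolding vv' D_op_scaleC[OF unit] by simp
  ultimately show ?thesis
    using that[of x' z \<beta>] x' z eig \<open>k = \<mu>\<close> unfolding v'_def by blast
qed

text \<open>The line of (e, 0) has eigenvalue \<open>c\<close>, any fixed point other than e has
  eigenvalue \<mu>, and the two values agree exactly when |\<mu>| = 1.\<close>

lemma hyperbolic_hat_iff:
  fixes e :: "'a::complex_hilbert_space"
  assumes unit: "norm e = 1" and S: "S \<in> G_hat e" and form: "stabilizer_form e \<mu> U b t S"
  shows "hyperbolic_hat e S \<longleftrightarrow> cmod \<mu> \<noteq> 1"
proof -
  define c where "c = inverse (cnj \<mu>)"
  have \<mu>: "\<mu> \<noteq> 0" and U: "unitary_on (perp e) U" and b: "b \<in> perp e"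
    using form by (auto simp: stabilizer_form_def)
  have S_coord: "S (\<alpha> *\<^sub>C e + y, z) =
      ((c * \<alpha> + cinner (U y) b + \<mu> * t * z) *\<^sub>C e + (U y + z *\<^sub>C \<mu> *\<^sub>C b), \<mu> * z)"
    if "y \<in> perp e" for \<alpha> y z
    using form that by (simp add: stabilizer_form_def c_def)
  have U0: "U 0 = 0" using unitary_on_scaleC[OF U perp_0, of 0] by simp
  have Se: "S (e, 0) = c *\<^sub>C (e, 0)"
    using S_coord[OF perp_0, of 1 0] by (simp add: U0 scaleC_prod_def scaleC_complex_def)
  define T where "T = D_op e \<circ> S \<circ> inv (D_op e)"
  have T: "T \<in> G" unfolding T_def by (rule conj_D_op_mem_G[OF unit S])
  \<comment> \<open>The conjugate T is determined by S, so the existential in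
    \<open>hyperbolic_hat\<close> concerns this one operator.\<close>
  have "S = inv (D_op e) \<circ> T' \<circ> D_op e \<longleftrightarrow> T' = T" for T'
    unfolding T_def fun_eq_iff o_apply by (metis D_op_inv[OF unit])
  then have hyp: "hyperbolic_hat e S \<longleftrightarrow> hyperbolic T"
    using T by (auto simp: hyperbolic_hat_def)
  let ?Fix = "{x \<in> cball 0 1. ball_action T x = x}"
  note cases = stabilizer_form_fixed_point_cases[OF unit S form, folded T_def]
  note eigenvector = G_hat_eigenvector_fixed_point[OF unit S, folded T_def]
  show ?thesis
  proof (cases "cmod \<mu> = 1")
    case True
    then have c: "c = \<mu>" unfolding c_def by (simp add: inverse_cnj_eq_iff[OF \<mu>])
    have "\<not> hyperbolic T"
    proof
      assume h: "hyperbolic T"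
      then have "card ?Fix = 2" "?Fix \<subseteq> sphere 0 1" by (auto simp: hyperbolic_def)
      then obtain x where x: "x \<in> ?Fix" "x \<noteq> e" "x \<in> sphere 0 1"
        by (metis (no_types, lifting) card_2_iff insert_iff subsetD)
      then have x1: "norm x \<le> 1" "ball_action T x = x" and norm_x: "norm x = 1" by auto
      obtain \<alpha> y z where y: "y \<in> perp e"
        and eig: "S (\<alpha> *\<^sub>C e + y, 1) = \<mu> *\<^sub>C (\<alpha> *\<^sub>C e + y, 1)"
        and "Re (form_A_hat e (\<alpha> *\<^sub>C e + y, 1) (\<alpha> *\<^sub>C e + y, 1)) =
          ((norm x)\<^sup>2 - 1) / (cmod z)\<^sup>2"
        by (rule cases[OF x1(1) x(2) x1(2)])
      then have null: "Re (- cnj \<alpha> - \<alpha> + cinner y y) = 0"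
        unfolding form_A_hat_coord[OF unit y y] norm_x by simp
      \<comment> \<open>Both boundary fixed points belong to the eigenvalue \<open>\<mu>\<close>, so the span of their
        eigenvectors, which contains negative vectors, consists of eigenvectors.\<close>
      define v where "v = ((\<alpha> + 1) *\<^sub>C e + y, 1::complex)"
      have v_sum: "v = (\<alpha> *\<^sub>C e + y, 1) + (e, 0)"
        by (simp add: v_def scaleC_add_left)
      have "S v = \<mu> *\<^sub>C v"
        unfolding v_sum G_hatD(2)[OF S] eig Se c scaleC_add_right ..
      \<comment> \<open>Adding (e, 0) to a null vector with last coordinate 1 contributes -1 through
        each of the two cross terms.\<close>
      moreover have neg: "Re (form_A_hat e v v) = - 2"
        unfolding v_def form_A_hat_coord[OF unit y y] using null by simp
      moreover have "v \<noteq> 0" by (simp add: v_def zero_prod_def)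
      ultimately obtain x' w where x': "w \<noteq> 0" "norm x' \<le> 1" "ball_action T x' = x'"
        "Re (form_A_hat e v v) = (cmod w)\<^sup>2 * ((norm x')\<^sup>2 - 1)"
        using eigenvector[of v \<mu>] by (metis neg_le_0_iff_le zero_le_numeral)
      have "norm x' \<noteq> 1" using x'(4) neg by auto
      then have "elliptic T" unfolding elliptic_def using x' by (intro bexI[of _ x']) auto
      with h show False by (simp add: hyperbolic_def)
    qed
    with True hyp show ?thesis by simp
  next
    case False
    then have c: "c \<noteq> \<mu>" unfolding c_def by (simp add: inverse_cnj_eq_iff[OF \<mu>])
    \<comment> \<open>The eigenvector for \<mu> is built from the middle block up: d solves the
      equation orthogonal to e, then q solves the scalar equation along e, which is possible because
      \<mu> differs from \<open>c\<close>.\<close>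
    obtain d where d: "d \<in> perp e" "U d + \<mu> *\<^sub>C b = \<mu> *\<^sub>C d"
      using unitary_on_resolvent[OF unit U False \<mu> perp_scaleC[OF b]] by blast
    define q where "q = (cinner (U d) b + \<mu> * t) / (\<mu> - c)"
    have q: "c * q + cinner (U d) b + \<mu> * t = \<mu> * q"
      using c by (simp add: q_def field_simps)
    define v where "v = (q *\<^sub>C e + d, 1::complex)"
    have eig: "S v = \<mu> *\<^sub>C v"
      unfolding v_def S_coord[OF d(1)]
      by (simp add: q d(2) scaleC_prod_def scaleC_complex_def scaleC_add_right scaleC_scaleC)
    \<comment> \<open>Invariance multiplies the form at v by |\<mu>|^2, which is not 1, so v is
      isotropic and its point lies on the sphere.\<close>
    have "form_A_hat e v v = \<mu> * cnj \<mu> * form_A_hat e v v"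
    proof -
      have "\<mu> *\<^sub>C v = ((\<mu> * q) *\<^sub>C e + \<mu> *\<^sub>C d, \<mu>)"
        by (simp add: v_def scaleC_prod_def scaleC_complex_def scaleC_add_right scaleC_scaleC)
      then have "form_A_hat e (S v) (S v) = \<mu> * cnj \<mu> * form_A_hat e v v"
        unfolding eig unfolding v_def
        by (simp only: form_A_hat_coord[OF unit] d(1) perp_scaleC)
          (simp add: cinner_simps algebra_simps)
      then show ?thesis by (simp only: G_hatD(4)[OF S])
    qed
    moreover have "\<mu> * cnj \<mu> \<noteq> 1"
      using c \<mu> by (auto simp: c_def field_simps)
    ultimately have null: "form_A_hat e v v = 0" by simp
    have "v \<noteq> 0" by (simp add: v_def zero_prod_def)
    then obtain x w where x: "D_op e v = w *\<^sub>C (x, 1)" "w \<noteq> 0" "norm x \<le> 1"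
        "ball_action T x = x" "0 = (cmod w)\<^sup>2 * ((norm x)\<^sup>2 - 1)"
      using eigenvector[of v \<mu>] eig null by (metis zero_complex.sel(1) order_refl)
    have norm_x: "norm x = 1"
      using x(2,5) by (simp add: power2_eq_1_iff) (smt (verit) norm_ge_zero)
    have De: "D_op e (e, 0) = complex_of_real (1 / sqrt 2) *\<^sub>C (e, 1)"
      by (rule D_op_e[OF unit])
    have fix_e: "ball_action T e = e"
    proof -
      have "Re (form_A_hat e (e, 0) (e, 0)) \<le> 0"
        using form_A_hat_coord[OF unit perp_0 perp_0, of 1 0 1 0] by simp
      moreover have "(e, 0::complex) \<noteq> 0" using unit by (auto simp: zero_prod_def)
      ultimately obtain x' w' where "D_op e (e, 0) = w' *\<^sub>C (x', 1)" "ball_action T x' = x'"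
        using eigenvector[OF Se] by metis
      then show ?thesis unfolding De scaleC_pair_1_eq_iff by auto
    qed
    have "x \<noteq> e"
    proof
      assume "x = e"
      have "D_op e ((w * sqrt 2) *\<^sub>C (e, 0)) = D_op e v"
        unfolding D_op_scaleC[OF unit] De x(1) \<open>x = e\<close> scaleC_scaleC by simp
      then have "(w * sqrt 2) *\<^sub>C (e, 0) = v" by (metis D_op_inv(2)[OF unit])
      then show False by (auto simp: v_def scaleC_prod_def scaleC_complex_def)
    qed
    have "x' = x" if x': "norm x' \<le> 1" "x' \<noteq> e" "ball_action T x' = x'" for x'
    proof -
      obtain \<alpha> y z where y: "y \<in> perp e" and z: "z \<noteq> 0"
        and Dx': "(x', 1) = z *\<^sub>C D_op e (\<alpha> *\<^sub>C e + y, 1)"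
        and eig': "S (\<alpha> *\<^sub>C e + y, 1) = \<mu> *\<^sub>C (\<alpha> *\<^sub>C e + y, 1)"
        by (rule cases[OF x'])
      have "(c * \<alpha> + cinner (U y) b + \<mu> * t) *\<^sub>C e + (U y + \<mu> *\<^sub>C b) =
          (\<mu> * \<alpha>) *\<^sub>C e + \<mu> *\<^sub>C y"
        using eig' unfolding S_coord[OF y]
        by (simp add: scaleC_prod_def scaleC_complex_def scaleC_add_right scaleC_scaleC)
      then have eqs: "c * \<alpha> + cinner (U y) b + \<mu> * t = \<mu> * \<alpha>" "U y + \<mu> *\<^sub>C b = \<mu> *\<^sub>C y"
        using y b by (simp_all add: coord_eq_iff[OF unit] perp_intros unitary_on_mem[OF U])
      \<comment> \<open>An isometry has no nonzero eigenvector for an eigenvalue off the unit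
        circle, so y = d; the scalar equation then leaves only \<alpha> = q.\<close>
      have "U (y - d) = \<mu> *\<^sub>C (y - d)"
        unfolding unitary_on_diff[OF U y d(1)] scaleC_diff_right eqs(2)[symmetric]
          d(2)[symmetric] by simp
      then have "norm (y - d) = cmod \<mu> * norm (y - d)"
        by (metis norm_scaleC unitary_on_norm[OF U perp_diff[OF y d(1)]])
      then have yd: "y = d" using False by simp
      have "(c - \<mu>) * \<alpha> = (c - \<mu>) * q"
        using eqs(1) q unfolding yd by algebra
      then have "\<alpha> = q" using c by simp
      then have "1 *\<^sub>C (x', 1) = (z * w) *\<^sub>C (x, 1::complex)"
        using Dx' x(1) unfolding v_def yd by (simp add: scaleC_scaleC)
      then show ?thesis unfolding scaleC_pair_1_eq_iff by simp
    qed
    then have Fix: "?Fix = {e, x}"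
      using unit fix_e x(3,4) by auto
    have "\<not> elliptic T"
    proof
      assume "elliptic T"
      then obtain x' where "x' \<in> ?Fix" "norm x' < 1" by (auto simp: elliptic_def)
      then show False unfolding Fix using unit norm_x by auto
    qed
    then have "hyperbolic T"
      unfolding hyperbolic_def Fix using \<open>x \<noteq> e\<close> unit norm_x by auto
    with False hyp show ?thesis by simp
  qed
qed

section \<open>Centralizers of Heisenberg translations\<close>

lemma stabilizer_form_eq_upper_block:
  fixes e :: "'a::complex_inner"
  assumes unit: "norm e = 1" and "stabilizer_form e \<mu> U b t S"
  shows "S = upper_block e (inverse (cnj \<mu>)) (\<lambda>x. cinner x (inv_into (perp e) U b)) (\<mu> * t)
    U (\<mu> *\<^sub>C b) \<mu>"
proof
  fix v :: "'a \<times> complex"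
  obtain \<alpha> y z where v: "v = (\<alpha> *\<^sub>C e + y, z)" "y \<in> perp e" by (rule coord_cases[OF unit])
  then show "S v = upper_block e (inverse (cnj \<mu>)) (\<lambda>x. cinner x (inv_into (perp e) U b)) (\<mu> * t)
      U (\<mu> *\<^sub>C b) \<mu> v"
    using assms(2) unfolding v(1) upper_block_coord[OF unit v(2)]
    by (simp add: stabilizer_form_def cinner_unitary_on_inv)
qed

lemma stabilizer_form_upper_block:
  fixes e :: "'a::complex_inner"
  assumes unit: "norm e = 1" and \<mu>: "cmod \<mu> = 1" and U: "unitary_on (perp e) U"
    and b: "b \<in> perp e" and t: "Re t = (norm b)\<^sup>2 / 2"
  shows "stabilizer_form e \<mu> U b t
    (upper_block e \<mu> (\<lambda>x. cinner x (inv_into (perp e) U b)) (\<mu> * t) U (\<mu> *\<^sub>C b) \<mu>)"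
proof -
  have "\<mu> \<noteq> 0" using \<mu> by auto
  with \<mu> have "inverse (cnj \<mu>) = \<mu>" by (metis inverse_cnj_eq_iff)
  then show ?thesis
    using \<open>\<mu> \<noteq> 0\<close> U b t
    by (simp add: stabilizer_form_def upper_block_coord[OF unit] cinner_unitary_on_inv[OF U])
qed

text \<open>For a = 0 only the scalar condition survives. It says that s times the difference of the
  two corner entries is 0.\<close>

lemma commute_vertical_iff:
  fixes e :: "'a::complex_inner"
  assumes unit: "norm e = 1" and form: "stabilizer_form e \<mu> U b t S"
    and lam: "lam \<noteq> 0" and s: "s \<noteq> 0"
  shows "S \<circ> heisenberg e lam 0 s = heisenberg e lam 0 s \<circ> S \<longleftrightarrow> cmod \<mu> = 1"
proof -
  have \<mu>: "\<mu> \<noteq> 0" and U: "unitary_on (perp e) U"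
    using form by (auto simp: stabilizer_form_def)
  have "U 0 = 0" using unitary_on_scaleC[OF U perp_0, of 0] by simp
  then show ?thesis
    using s by (simp add: commute_heisenberg_iff[OF unit form lam perp_0] inverse_cnj_eq_iff[OF \<mu>])
qed

text \<open>Since U preserves norms and a is nonzero, U a = \<mu> a forces |\<mu>| = 1. The
  condition on y is then unitarity of U, and the scalar condition reduces to
  \<open>cinner a b = cinner b a\<close>.\<close>

lemma commute_nonvertical_iff:
  fixes e :: "'a::complex_inner"
  assumes unit: "norm e = 1" and form: "stabilizer_form e \<mu> U b t S"
    and lam: "lam \<noteq> 0" and a: "a \<in> perp e" "a \<noteq> 0"
  shows "S \<circ> heisenberg e lam a s = heisenberg e lam a s \<circ> S \<longleftrightarrow>
    cmod \<mu> = 1 \<and> U a = \<mu> *\<^sub>C a \<and> cinner b a \<in> \<real>"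
proof (cases "cmod \<mu> = 1 \<and> U a = \<mu> *\<^sub>C a")
  case True
  have \<mu>: "\<mu> \<noteq> 0" and U: "unitary_on (perp e) U"
    using form by (auto simp: stabilizer_form_def)
  have c: "inverse (cnj \<mu>) = \<mu>" using True by (simp add: inverse_cnj_eq_iff[OF \<mu>])
  have "\<mu> * cinner y a = cinner (U y) a" if "y \<in> perp e" for y
  proof -
    have "cinner y a = cnj \<mu> * cinner (U y) a"
      using unitary_on_cinner[OF U that a(1)] True by (simp add: cinner_simps)
    then show ?thesis using c \<mu> by (simp add: field_simps)
  qed
  moreover have "\<mu> * s + cinner (\<mu> *\<^sub>C a) b = \<mu> * (cinner b a + s) \<longleftrightarrow> cinner b a \<in> \<real>"
    using \<mu> cinner_commute[of a b]
    by (auto simp: cinner_simps distrib_left complex_is_Real_iff complex_eq_iff)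
  ultimately show ?thesis
    using True by (simp add: commute_heisenberg_iff[OF unit form lam a(1)] c)
next
  case False
  have U: "unitary_on (perp e) U" using form by (auto simp: stabilizer_form_def)
  have "cmod \<mu> = 1" if "U a = \<mu> *\<^sub>C a"
    using unitary_on_norm[OF U a(1)] a(2) by (simp add: that norm_scaleC)
  with False show ?thesis
    by (auto simp: commute_heisenberg_iff[OF unit form lam a(1)])
qed

theorem theorem1p7:
  fixes e a :: "'a::complex_hilbert_space" and lam s :: complex
  assumes "norm e = 1"
    and "cmod lam = 1" and "a \<in> perp e" and "s \<noteq> 0" and "Re s = (norm a)\<^sup>2 / 2"
  shows "(a = 0 \<longrightarrow>
      centralizer (G_hat e) (heisenberg e lam a s) =
        {S \<in> G_hat_infinity e. \<not> hyperbolic_hat e S}) \<and>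
    (a \<noteq> 0 \<longrightarrow>
      centralizer (G_hat e) (heisenberg e lam a s) =
        {S \<in> G_hat_infinity e. \<exists>lam' U b t.
           S = upper_block e lam' (\<lambda>x. cinner x (inv_into (perp e) U b)) (lam' * t)
                 U (lam' *\<^sub>C b) lam' \<and>
           lam' * cnj lam' = 1 \<and> unitary_on (perp e) U \<and> b \<in> perp e \<and>
           Re t = (norm b)\<^sup>2 / 2 \<and>
           U a = lam' *\<^sub>C a \<and> cinner b a \<in> \<real>})"
proof (intro conjI impI)
  note unit = assms(1)
  have lam: "lam \<noteq> 0" using assms(2) by auto
  have centralizer: "centralizer (G_hat e) (heisenberg e lam a s) =
      {S \<in> G_hat_infinity e. S \<circ> heisenberg e lam a s = heisenberg e lam a s \<circ> S}"
    using commute_heisenberg_imp_infinity[OF unit _ lam assms(3,4)]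
    by (auto simp: centralizer_def G_hat_infinity_def)
  {
    assume "a = 0"
    have "S \<circ> heisenberg e lam a s = heisenberg e lam a s \<circ> S \<longleftrightarrow> \<not> hyperbolic_hat e S"
      if S: "S \<in> G_hat_infinity e" for S
    proof -
      obtain \<mu> U b t where form: "stabilizer_form e \<mu> U b t S"
        using G_hat_infinity_stabilizer_form[OF unit S] by blast
      have "S \<in> G_hat e" using S by (simp add: G_hat_infinity_def)
      from hyperbolic_hat_iff[OF unit this form] commute_vertical_iff[OF unit form lam assms(4)]
      show ?thesis using \<open>a = 0\<close> by simp
    qed
    then show "centralizer (G_hat e) (heisenberg e lam a s) =
        {S \<in> G_hat_infinity e. \<not> hyperbolic_hat e S}"
      unfolding centralizer by blast
  }
  {
    assume a: "a \<noteq> 0"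
    have norm_1: "cmod \<mu> = 1 \<longleftrightarrow> \<mu> * cnj \<mu> = 1" for \<mu>
      using inverse_cnj_eq_iff[of \<mu>] by (cases "\<mu> = 0") (auto simp: field_simps)
    have "S \<circ> heisenberg e lam a s = heisenberg e lam a s \<circ> S \<longleftrightarrow> (\<exists>lam' U b t.
        S = upper_block e lam' (\<lambda>x. cinner x (inv_into (perp e) U b)) (lam' * t)
              U (lam' *\<^sub>C b) lam' \<and>
        lam' * cnj lam' = 1 \<and> unitary_on (perp e) U \<and> b \<in> perp e \<and>
        Re t = (norm b)\<^sup>2 / 2 \<and>
        U a = lam' *\<^sub>C a \<and> cinner b a \<in> \<real>)" (is "?C \<longleftrightarrow> ?R")
      if S: "S \<in> G_hat_infinity e" for S
    proof
      assume ?C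
      obtain \<mu> U b t where form: "stabilizer_form e \<mu> U b t S"
        using G_hat_infinity_stabilizer_form[OF unit S] by blast
      have cond: "cmod \<mu> = 1" "U a = \<mu> *\<^sub>C a" "cinner b a \<in> \<real>"
        using \<open>?C\<close> commute_nonvertical_iff[OF unit form lam assms(3) a] by auto
      have c: "inverse (cnj \<mu>) = \<mu>"
        using form cond(1) by (simp add: stabilizer_form_def inverse_cnj_eq_iff)
      show ?R
        using stabilizer_form_eq_upper_block[OF unit form, unfolded c] form cond norm_1[of \<mu>]
        unfolding stabilizer_form_def by blast
    next
      assume ?R
      then obtain \<mu> U b t where
        S_eq: "S = upper_block e \<mu> (\<lambda>x. cinner x (inv_into (perp e) U b)) (\<mu> * t) U (\<mu> *\<^sub>C b) \<mu>"
        and R: "\<mu> * cnj \<mu> = 1" "unitary_on (perp e) U" "b \<in> perp e" "Re t = (norm b)\<^sup>2 / 2"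
          "U a = \<mu> *\<^sub>C a" "cinner b a \<in> \<real>"
        by blast
      have "cmod \<mu> = 1" using R(1) norm_1 by blast
      \<comment> \<open>The given data are put in stabilizer form directly, so they need not be
        compared with those produced by \<open>G_hat_infinity_stabilizer_form\<close>.\<close>
      note form = stabilizer_form_upper_block[OF unit this R(2-4), folded S_eq]
      show ?C
        using commute_nonvertical_iff[OF unit form lam assms(3) a] R \<open>cmod \<mu> = 1\<close> by blast
    qed
    then show "centralizer (G_hat e) (heisenberg e lam a s) =
        {S \<in> G_hat_infinity e. \<exists>lam' U b t.
           S = upper_block e lam' (\<lambda>x. cinner x (inv_into (perp e) U b)) (lam' * t)
                 U (lam' *\<^sub>C b) lam' \<and>
           lam' * cnj lam' = 1 \<and> unitary_on (perp e) U \<and> b \<in> perp e \<and>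
           Re t = (norm b)\<^sup>2 / 2 \<and>
           U a = lam' *\<^sub>C a \<and> cinner b a \<in> \<real>}"
      unfolding centralizer by blast
  }
qed

end
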